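(* Let Alice and Bob hold systems $A$ and $B$, each with Hilbert space $\mathbb{C}^5$ and standard orthonormal basis $|0\rangle,\dots,|4\rangle$. Consider the following set of 17 mutually orthogonal (unnormalized) product states in $\mathbb{C}^5\otimes\mathbb{C}^5$ (first factor Alice, second factor Bob): $$\begin{aligned} &|\phi_{1}\rangle=|0\rangle|0-1+2-3\rangle,\quad |\phi_{2}\rangle=|0\rangle|0+1-2-3\rangle,\quad |\phi_{3}\rangle=|0\rangle|0-1-2+3\rangle,\\ &|\phi_{4}\rangle=|0-1+2-3\rangle|4\rangle,\quad |\phi_{5}\rangle=|0+1-2-3\rangle|4\rangle,\quad |\phi_{6}\rangle=|0-1-2+3\rangle|4\rangle,\\ &|\phi_{7}\rangle=|4\rangle|1-2+3-4\rangle,\quad |\phi_{8}\rangle=|4\rangle|1+2-3-4\rangle,\quad |\phi_{9}\rangle=|4\rangle|1-2-3+4\rangle,\\ &|\phi_{10}\rangle=|1-2+3-4\rangle|0\rangle,\quad |\phi_{11}\rangle=|1+2-3-4\rangle|0\rangle,\quad |\phi_{12}\rangle=|1-2-3+4\rangle|0\rangle,\\ &|\phi_{13}\rangle=|1\rangle|1-2\rangle,\quad |\phi_{14}\rangle=|1-2\rangle|3\rangle,\quad |\phi_{15}\rangle=|3\rangle|2-3\rangle,\quad |\phi_{16}\rangle=|2-3\rangle|1\rangle,\\ &|F\rangle=|0+1+2+3+4\rangle|0+1+2+3+4\rangle . \end{aligned}$$ Then the states $|\phi_1\rangle,\dots,|\phi_{16}\rangle,|F\rangle$ can be perfectly distinguished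 by LOCC with the assistance of one $3\otimes 3$ maximally entangled state shared between Alice and Bob.
   Context: Notation: $|i\pm j\pm\cdots\rangle$ means $|i\rangle\pm|j\rangle\pm\cdots$ (inside the ket the labels are basis labels, not numbers to be added), and normalization constants are ignored. A $q\otimes q$ maximally entangled state is the state (proportional to) $|\Psi\rangle_{ab}=\sum_{i=0}^{q-1}|i\rangle_a|i\rangle_b\in\mathbb{C}^q\otimes\mathbb{C}^q$, with ancillary system $a$ held by Alice and $b$ held by Bob. LOCC (local operations and classical communication): a protocol consists of finitely many rounds; in each round one of the parties performs a quantum measurement (Kraus operators $\{M_x\}$ with $\sum_x M_x^\dagger M_x=I$) acting only on that party's own systems, the choice of the measurement being allowed to depend on all previous outcomes, and the outcome is communicated to the other party. A finite set $S$ of pairwise orthogonal states of $AB$ is perfectly distinguished by LOCC with the assistance of a shared entangled state $|\Psi\rangle_{ab}$ if there is an LOCC protocol, in which Alice acts on $aA$ and Bob acts on $bB$, such that when it is applied to $|\phi\rangle_{AB}\otimes|\Psi\rangle_{ab}$ with $|\phi\rangle\in S$ unknown, the sequence of measurement outcomes determines $|\phi\rangle$ with certainty; i.e. for every complete sequence of outcomes, at most one $|\phi\rangle\in S$ gives it nonzero probability. *)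

theory Defs
  imports "HOL-Analysis.Analysis"
begin

section \<open>Vectors and operators\<close>

text \<open>
  The Hilbert space with orthonormal basis indexed by a finite type \<open>'n\<close> is \<open>complex^'n\<close>, and the
  tensor product of \<open>complex^'m\<close> and \<open>complex^'n\<close> is \<open>complex^('m \<times> 'n)\<close>. The library norm on
  \<open>complex^'n\<close> is the usual Hilbert space norm, but the library inner product is only the real
  part of the Hermitian one; hence \<open>hinner\<close> below. The numeral type \<open>5\<close> consists of the residues
  \<open>0, 1, 2, 3, 4\<close>, which serve as basis labels.
\<close>

definition hinner :: "complex^'n \<Rightarrow> complex^'n \<Rightarrow> complex" where
  "hinner u v = (\<Sum>i\<in>UNIV. cnj (u $ i) * v $ i)"

definition ket :: "'n \<Rightarrow> complex^'n" where
  "ket i = axis i 1"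

definition tensor_vec :: "complex^'m \<Rightarrow> complex^'n \<Rightarrow> complex^('m \<times> 'n)"
    (infixl "\<otimes>\<^sub>v" 70) where
  "u \<otimes>\<^sub>v v = (\<chi> p. u $ fst p * v $ snd p)"

definition tensor_mat :: "complex^'m^'m \<Rightarrow> complex^'n^'n \<Rightarrow> complex^('m \<times> 'n)^('m \<times> 'n)"
    (infixl "\<otimes>\<^sub>m" 70) where
  "M \<otimes>\<^sub>m N = (\<chi> p q. M $ fst p $ fst q * N $ snd p $ snd q)"

definition dagger :: "complex^'n^'m \<Rightarrow> complex^'m^'n" where
  "dagger M = (\<chi> i j. cnj (M $ j $ i))"

section \<open>LOCC protocols\<close>

text \<open>
  A protocol is a tree. In a node \<open>Alice n M P\<close> Alice measures with Kraus operators \<open>M x\<close> for the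
  outcomes \<open>x < n\<close>, and after announcing \<open>x\<close> the parties continue with \<open>P x\<close>; the values of
  \<open>M\<close> and \<open>P\<close> at arguments \<open>x \<ge> n\<close> are irrelevant. Every branch of such a tree is finite and
  only finitely many branches are relevant at each node, so the number of rounds is bounded.
\<close>

datatype ('a::finite, 'b::finite) locc =
    Finish
  | Alice nat "nat \<Rightarrow> complex^'a^'a" "nat \<Rightarrow> ('a, 'b) locc"
  | Bob nat "nat \<Rightarrow> complex^'b^'b" "nat \<Rightarrow> ('a, 'b) locc"

definition is_measurement :: "nat \<Rightarrow> (nat \<Rightarrow> complex^'n^'n) \<Rightarrow> bool" where
  "is_measurement n M \<longleftrightarrow> (\<Sum>x<n. dagger (M x) ** M x) = mat 1"

primrec valid_locc :: "('a::finite, 'b::finite) locc \<Rightarrow> bool" where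
  "valid_locc Finish \<longleftrightarrow> True"
| "valid_locc (Alice n M P) \<longleftrightarrow> is_measurement n M \<and> (\<forall>x<n. valid_locc (P x))"
| "valid_locc (Bob n M P) \<longleftrightarrow> is_measurement n M \<and> (\<forall>x<n. valid_locc (P x))"

primrec outcomes :: "('a::finite, 'b::finite) locc \<Rightarrow> nat list set" where
  "outcomes Finish = {[]}"
| "outcomes (Alice n M P) = {x # xs |x xs. x < n \<and> xs \<in> outcomes (P x)}"
| "outcomes (Bob n M P) = {x # xs |x xs. x < n \<and> xs \<in> outcomes (P x)}"

text \<open>
  The unnormalized state to which the initial state \<open>\<psi>\<close> is taken when the outcome sequence is
  \<open>xs\<close>; meaningful only for \<open>xs \<in> outcomes P\<close>.
\<close>

primrec post_state ::
    "('a::finite, 'b::finite) locc \<Rightarrow> nat list \<Rightarrow> complex^('a \<times> 'b) \<Rightarrow> complex^('a \<times> 'b)" where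
  "post_state Finish xs \<psi> = \<psi>"
| "post_state (Alice n M P) xs \<psi> =
     post_state (P (hd xs)) (tl xs) ((M (hd xs) \<otimes>\<^sub>m mat 1) *v \<psi>)"
| "post_state (Bob n M P) xs \<psi> =
     post_state (P (hd xs)) (tl xs) ((mat 1 \<otimes>\<^sub>m M (hd xs)) *v \<psi>)"

text \<open>Dividing by the squared norm of \<open>\<psi>\<close> accounts for initial states that are not normalized.\<close>

definition outcome_prob ::
    "('a::finite, 'b::finite) locc \<Rightarrow> nat list \<Rightarrow> complex^('a \<times> 'b) \<Rightarrow> real" where
  "outcome_prob P xs \<psi> = (norm (post_state P xs \<psi>))\<^sup>2 / (norm \<psi>)\<^sup>2"

section \<open>Entanglement-assisted discrimination\<close>

definition max_entangled :: "complex^('q::finite \<times> 'q)" where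
  "max_entangled = (\<Sum>i\<in>UNIV. ket i \<otimes>\<^sub>v ket i)"

text \<open>
  The state \<open>\<phi>\<close> of \<open>AB\<close> together with the state \<open>\<Psi>\<close> of the ancillas \<open>ab\<close>, with the tensor factors
  rearranged so that Alice holds \<open>aA\<close> and Bob holds \<open>bB\<close>.
\<close>

definition with_ancilla ::
    "complex^('x::finite \<times> 'y::finite) \<Rightarrow> complex^('m::finite \<times> 'n::finite)
      \<Rightarrow> complex^(('x \<times> 'm) \<times> ('y \<times> 'n))" where
  "with_ancilla \<Psi> \<phi> =
     (\<chi> p. \<Psi> $ (fst (fst p), fst (snd p)) * \<phi> $ (snd (fst p), snd (snd p)))"

definition locc_distinguishable_with ::
    "complex^('x::finite \<times> 'y::finite) \<Rightarrow> (complex^('m::finite \<times> 'n::finite)) set \<Rightarrow> bool" where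
  "locc_distinguishable_with \<Psi> S \<longleftrightarrow>
     (\<exists>P :: ('x \<times> 'm, 'y \<times> 'n) locc. valid_locc P \<and>
        (\<forall>xs\<in>outcomes P. \<forall>\<phi>\<in>S. \<forall>\<phi>'\<in>S.
           outcome_prob P xs (with_ancilla \<Psi> \<phi>) \<noteq> 0 \<and>
           outcome_prob P xs (with_ancilla \<Psi> \<phi>') \<noteq> 0 \<longrightarrow> \<phi> = \<phi>'))"

section \<open>The seventeen product states\<close>

definition product_states :: "(complex^(5 \<times> 5)) list" where
  "product_states =
    [ket 0 \<otimes>\<^sub>v (ket 0 - ket 1 + ket 2 - ket 3),
     ket 0 \<otimes>\<^sub>v (ket 0 + ket 1 - ket 2 - ket 3),
     ket 0 \<otimes>\<^sub>v (ket 0 - ket 1 - ket 2 + ket 3),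
     (ket 0 - ket 1 + ket 2 - ket 3) \<otimes>\<^sub>v ket 4,
     (ket 0 + ket 1 - ket 2 - ket 3) \<otimes>\<^sub>v ket 4,
     (ket 0 - ket 1 - ket 2 + ket 3) \<otimes>\<^sub>v ket 4,
     ket 4 \<otimes>\<^sub>v (ket 1 - ket 2 + ket 3 - ket 4),
     ket 4 \<otimes>\<^sub>v (ket 1 + ket 2 - ket 3 - ket 4),
     ket 4 \<otimes>\<^sub>v (ket 1 - ket 2 - ket 3 + ket 4),
     (ket 1 - ket 2 + ket 3 - ket 4) \<otimes>\<^sub>v ket 0,
     (ket 1 + ket 2 - ket 3 - ket 4) \<otimes>\<^sub>v ket 0,
     (ket 1 - ket 2 - ket 3 + ket 4) \<otimes>\<^sub>v ket 0,
     ket 1 \<otimes>\<^sub>v (ket 1 - ket 2),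
     (ket 1 - ket 2) \<otimes>\<^sub>v ket 3,
     ket 3 \<otimes>\<^sub>v (ket 2 - ket 3),
     (ket 2 - ket 3) \<otimes>\<^sub>v ket 1,
     (ket 0 + ket 1 + ket 2 + ket 3 + ket 4) \<otimes>\<^sub>v (ket 0 + ket 1 + ket 2 + ket 3 + ket 4)]"

end

theory Submission
  imports Defs
begin

text \<open>
  The supports of the first sixteen states are eight strips, arranged in the \<open>5 \<times> 5\<close> grid of basis
  labels as two nested windmills around the cell \<open>(2, 2)\<close>, and on every strip the restrictions of
  the seventeen states are orthogonal. It suffices to find out in which strip the state lies: in
  a horizontal strip Bob then measures in an orthogonal basis, in a vertical one Bob erases his copy
  of Alice's label and Alice measures.

  Alice uses the entangled pair to give Bob a coherent copy of the class of her basis label in the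
  partition \<open>{0, 1}, {2, 3}, {4}\<close>. A local projective measurement may then separate two sets of cells
  for Alice if they share no row, and for Bob if no cell of one agrees with a cell of the other in
  both its column and the class of its row. Splitting off one strip at a time in the order
  \<open>\<phi>\<^sub>4\<dots>\<phi>\<^sub>6\<close> (Bob), \<open>\<phi>\<^sub>1\<^sub>6\<close> (Bob), \<open>\<phi>\<^sub>7\<dots>\<phi>\<^sub>9\<close> (Bob), \<open>\<phi>\<^sub>1\<dots>\<phi>\<^sub>3\<close> (Alice), \<open>\<phi>\<^sub>1\<^sub>0\<dots>\<phi>\<^sub>1\<^sub>2\<close> (Bob), \<open>\<phi>\<^sub>1\<^sub>3\<close> (Bob),
  \<open>\<phi>\<^sub>1\<^sub>5\<close> (Alice), \<open>\<phi>\<^sub>1\<^sub>4\<close> (Bob), only the centre remains.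
\<close>

section \<open>Discriminating families of states\<close>

text \<open>The index \<open>m\<close>, not the vector \<open>f m\<close>, is to be identified:
  \<open>f\<close> changes with every measurement and may become non-injective, while
  \<open>I\<close> stays fixed.\<close>

definition discriminable :: "'i set \<Rightarrow> ('i \<Rightarrow> complex^('a::finite \<times> 'b::finite)) \<Rightarrow> bool" where
  "discriminable I f \<longleftrightarrow>
     (\<exists>P :: ('a, 'b) locc. valid_locc P \<and>
        (\<forall>xs\<in>outcomes P. \<forall>m\<in>I. \<forall>m'\<in>I.
           post_state P xs (f m) \<noteq> 0 \<and> post_state P xs (f m') \<noteq> 0 \<longrightarrow> m = m'))"

lemma discriminable_finish:
  assumes "\<And>m m'. m \<in> I \<Longrightarrow> m' \<in> I \<Longrightarrow> f m \<noteq> 0 \<Longrightarrow> f m' \<noteq> 0 \<Longrightarrow> m = m'"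
  shows "discriminable I f"
  unfolding discriminable_def by (rule exI[of _ Finish]) (use assms in auto)

text \<open>Backward step of building a protocol tree: continuations chosen for each outcome are
  glued below a root. Outcomes range over any finite set, renumbered by a bijection
  \<open>h\<close>, so sets and options can serve as outcomes.\<close>

lemma discriminable_Alice:
  fixes M :: "'x \<Rightarrow> complex^'a^'a" and f :: "'i \<Rightarrow> complex^('a::finite \<times> 'b::finite)"
  assumes "finite X" and M: "(\<Sum>x\<in>X. dagger (M x) ** M x) = mat 1"
    and "\<And>x. x \<in> X \<Longrightarrow> discriminable I (\<lambda>m. (M x \<otimes>\<^sub>m mat 1) *v f m)"
  shows "discriminable I f"
proof -
  obtain h where h: "bij_betw h {..<card X} X"
    using \<open>finite X\<close> bij_betw_from_nat_into_finite by blast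
  have "\<exists>P :: ('a, 'b) locc. valid_locc P \<and> (\<forall>xs\<in>outcomes P. \<forall>m\<in>I. \<forall>m'\<in>I.
           post_state P xs ((M x \<otimes>\<^sub>m mat 1) *v f m) \<noteq> 0 \<and>
           post_state P xs ((M x \<otimes>\<^sub>m mat 1) *v f m') \<noteq> 0 \<longrightarrow> m = m')" if "x \<in> X" for x
    using assms(3)[OF that] unfolding discriminable_def .
  then obtain Q :: "'x \<Rightarrow> ('a, 'b) locc" where Q: "\<And>x. x \<in> X \<Longrightarrow> valid_locc (Q x)"
    "\<And>x xs m m'. x \<in> X \<Longrightarrow> xs \<in> outcomes (Q x) \<Longrightarrow> m \<in> I \<Longrightarrow> m' \<in> I \<Longrightarrow>
       post_state (Q x) xs ((M x \<otimes>\<^sub>m mat 1) *v f m) \<noteq> 0 \<Longrightarrow>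
       post_state (Q x) xs ((M x \<otimes>\<^sub>m mat 1) *v f m') \<noteq> 0 \<Longrightarrow> m = m'"
    by metis
  have hX: "h x \<in> X" if "x < card X" for x
    using h that by (auto simp: bij_betw_def)
  show ?thesis
    unfolding discriminable_def
  proof (intro exI conjI)
    show "valid_locc (Alice (card X) (M \<circ> h) (Q \<circ> h))"
      using M sum.reindex_bij_betw[OF h, of "\<lambda>x. dagger (M x) ** M x"] Q(1) hX
      by (simp add: is_measurement_def)
    show "\<forall>xs\<in>outcomes (Alice (card X) (M \<circ> h) (Q \<circ> h)). \<forall>m\<in>I. \<forall>m'\<in>I.
        post_state (Alice (card X) (M \<circ> h) (Q \<circ> h)) xs (f m) \<noteq> 0 \<and>
        post_state (Alice (card X) (M \<circ> h) (Q \<circ> h)) xs (f m') \<noteq> 0 \<longrightarrow> m = m'"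
      by clarsimp (rule Q(2)[OF hX])
  qed
qed

lemma discriminable_Bob:
  fixes M :: "'x \<Rightarrow> complex^'b^'b" and f :: "'i \<Rightarrow> complex^('a::finite \<times> 'b::finite)"
  assumes "finite X" and M: "(\<Sum>x\<in>X. dagger (M x) ** M x) = mat 1"
    and "\<And>x. x \<in> X \<Longrightarrow> discriminable I (\<lambda>m. (mat 1 \<otimes>\<^sub>m M x) *v f m)"
  shows "discriminable I f"
proof -
  obtain h where h: "bij_betw h {..<card X} X"
    using \<open>finite X\<close> bij_betw_from_nat_into_finite by blast
  have "\<exists>P :: ('a, 'b) locc. valid_locc P \<and> (\<forall>xs\<in>outcomes P. \<forall>m\<in>I. \<forall>m'\<in>I.
           post_state P xs ((mat 1 \<otimes>\<^sub>m M x) *v f m) \<noteq> 0 \<and>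
           post_state P xs ((mat 1 \<otimes>\<^sub>m M x) *v f m') \<noteq> 0 \<longrightarrow> m = m')" if "x \<in> X" for x
    using assms(3)[OF that] unfolding discriminable_def .
  then obtain Q :: "'x \<Rightarrow> ('a, 'b) locc" where Q: "\<And>x. x \<in> X \<Longrightarrow> valid_locc (Q x)"
    "\<And>x xs m m'. x \<in> X \<Longrightarrow> xs \<in> outcomes (Q x) \<Longrightarrow> m \<in> I \<Longrightarrow> m' \<in> I \<Longrightarrow>
       post_state (Q x) xs ((mat 1 \<otimes>\<^sub>m M x) *v f m) \<noteq> 0 \<Longrightarrow>
       post_state (Q x) xs ((mat 1 \<otimes>\<^sub>m M x) *v f m') \<noteq> 0 \<Longrightarrow> m = m'"
    by metis
  have hX: "h x \<in> X" if "x < card X" for x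
    using h that by (auto simp: bij_betw_def)
  show ?thesis
    unfolding discriminable_def
  proof (intro exI conjI)
    show "valid_locc (Bob (card X) (M \<circ> h) (Q \<circ> h))"
      using M sum.reindex_bij_betw[OF h, of "\<lambda>x. dagger (M x) ** M x"] Q(1) hX
      by (simp add: is_measurement_def)
    show "\<forall>xs\<in>outcomes (Bob (card X) (M \<circ> h) (Q \<circ> h)). \<forall>m\<in>I. \<forall>m'\<in>I.
        post_state (Bob (card X) (M \<circ> h) (Q \<circ> h)) xs (f m) \<noteq> 0 \<and>
        post_state (Bob (card X) (M \<circ> h) (Q \<circ> h)) xs (f m') \<noteq> 0 \<longrightarrow> m = m'"
      by clarsimp (rule Q(2)[OF hX])
  qed
qed

section \<open>Local operators acting on bipartite vectors\<close>

lemma tensor_mat_one_mult_nth: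
  "((M \<otimes>\<^sub>m mat 1) *v f) $ z = (\<Sum>r\<in>UNIV. M $ fst z $ r * f $ (r, snd z))"
proof -
  have "((M \<otimes>\<^sub>m mat 1) *v f) $ z =
      (\<Sum>w\<in>UNIV \<times> UNIV. case w of (r, s) \<Rightarrow>
        M $ fst z $ r * (if snd z = s then 1 else 0) * f $ (r, s))"
    by (simp add: matrix_vector_mult_def tensor_mat_def mat_def case_prod_beta)
  also have "\<dots> = (\<Sum>r\<in>UNIV. \<Sum>s\<in>UNIV. if snd z = s then M $ fst z $ r * f $ (r, s) else 0)"
    unfolding sum.cartesian_product[symmetric] by (intro sum.cong) auto
  finally show ?thesis by simp
qed

lemma one_tensor_mat_mult_nth:
  "((mat 1 \<otimes>\<^sub>m M) *v f) $ z = (\<Sum>s\<in>UNIV. M $ snd z $ s * f $ (fst z, s))"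
proof -
  have "((mat 1 \<otimes>\<^sub>m M) *v f) $ z =
      (\<Sum>w\<in>UNIV \<times> UNIV. case w of (r, s) \<Rightarrow>
        (if fst z = r then 1 else 0) * M $ snd z $ s * f $ (r, s))"
    by (simp add: matrix_vector_mult_def tensor_mat_def mat_def case_prod_beta)
  also have "\<dots> = (\<Sum>r\<in>UNIV. \<Sum>s\<in>UNIV. (if fst z = r then 1 else 0) * M $ snd z $ s * f $ (r, s))"
    unfolding sum.cartesian_product[symmetric] by (intro sum.cong) auto
  also have "\<dots> = (\<Sum>r\<in>UNIV. if fst z = r then \<Sum>s\<in>UNIV. M $ snd z $ s * f $ (r, s) else 0)"
    by (intro sum.cong) auto
  finally show ?thesis by simp
qed

lemma tensor_mat_one_mult_tensor_vec: "(M \<otimes>\<^sub>m mat 1) *v (u \<otimes>\<^sub>v w) = (M *v u) \<otimes>\<^sub>v w"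
  unfolding vec_eq_iff tensor_mat_one_mult_nth
  by (simp add: tensor_vec_def matrix_vector_mult_def sum_distrib_right mult.assoc)

lemma one_tensor_mat_mult_tensor_vec: "(mat 1 \<otimes>\<^sub>m M) *v (u \<otimes>\<^sub>v w) = u \<otimes>\<^sub>v (M *v w)"
  unfolding vec_eq_iff one_tensor_mat_mult_nth
  by (simp add: tensor_vec_def matrix_vector_mult_def sum_distrib_left mult_ac)

lemma tensor_vec_zero: "0 \<otimes>\<^sub>v w = 0" "u \<otimes>\<^sub>v 0 = 0"
  by (simp_all add: vec_eq_iff tensor_vec_def)

section \<open>Local measurements\<close>

definition coord_proj :: "'n set \<Rightarrow> complex^'n^'n" where
  "coord_proj R = (\<chi> p q. if q = p then if p \<in> R then 1 else 0 else 0)"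

lemma sum_coord_proj: "(\<Sum>q\<in>UNIV. coord_proj R $ p $ q * g q) = (if p \<in> R then g p else 0)"
proof -
  have "(\<Sum>q\<in>UNIV. coord_proj R $ p $ q * g q) =
      (\<Sum>q\<in>UNIV. if q = p then if p \<in> R then g p else 0 else 0)"
    by (intro sum.cong) (auto simp: coord_proj_def)
  then show ?thesis by simp
qed

lemma coord_proj_measurement:
  fixes R :: "'x \<Rightarrow> 'n::finite set"
  assumes "finite X" and "\<And>p. \<exists>!x. x \<in> X \<and> p \<in> R x"
  shows "(\<Sum>x\<in>X. dagger (coord_proj (R x)) ** coord_proj (R x)) = mat 1"
proof -
  have dagger: "dagger (coord_proj A) = coord_proj A" for A :: "'n set"
    by (auto simp: vec_eq_iff dagger_def coord_proj_def)
  have *: "dagger (coord_proj A) ** coord_proj A = coord_proj A" for A :: "'n set"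
    unfolding vec_eq_iff dagger by (simp add: matrix_matrix_mult_def sum_coord_proj)
      (simp add: coord_proj_def)
  have "(\<Sum>x\<in>X. if p \<in> R x then 1 else 0 :: complex) = 1" for p
  proof -
    obtain x where "x \<in> X" and x: "\<And>y. y \<in> X \<Longrightarrow> p \<in> R y \<longleftrightarrow> y = x"
      using assms(2) by metis
    have "(\<Sum>y\<in>X. if p \<in> R y then 1 else 0 :: complex) = (\<Sum>y\<in>X. if y = x then 1 else 0)"
      by (intro sum.cong refl) (simp add: x)
    with \<open>finite X\<close> \<open>x \<in> X\<close> show ?thesis by simp
  qed
  then have "(\<Sum>x\<in>X. coord_proj (R x)) $ p $ q = (if p = q then 1 else 0)" for p q
    by (cases "p = q") (simp_all add: coord_proj_def)
  then show ?thesis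
    unfolding * by (simp add: vec_eq_iff mat_def)
qed

lemma discriminable_Alice_split:
  assumes "discriminable I (\<lambda>m. \<chi> z. if fst z \<in> R then f m $ z else 0)"
    and "discriminable I (\<lambda>m. \<chi> z. if fst z \<notin> R then f m $ z else 0)"
  shows "discriminable I f"
proof (rule discriminable_Alice[OF _ coord_proj_measurement[of "{R, - R}" id]])
  have "(coord_proj R \<otimes>\<^sub>m mat 1) *v f m = (\<chi> z. if fst z \<in> R then f m $ z else 0)" for R m
    unfolding vec_eq_iff tensor_mat_one_mult_nth by (simp add: sum_coord_proj)
  then show "discriminable I (\<lambda>m. (coord_proj (id R') \<otimes>\<^sub>m mat 1) *v f m)" if "R' \<in> {R, - R}" for R'
    using that assms by auto
qed auto

lemma discriminable_Bob_split:
  assumes "discriminable I (\<lambda>m. \<chi> z. if snd z \<in> R then f m $ z else 0)"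
    and "discriminable I (\<lambda>m. \<chi> z. if snd z \<notin> R then f m $ z else 0)"
  shows "discriminable I f"
proof (rule discriminable_Bob[OF _ coord_proj_measurement[of "{R, - R}" id]])
  have "(mat 1 \<otimes>\<^sub>m coord_proj R) *v f m = (\<chi> z. if snd z \<in> R then f m $ z else 0)" for R m
    unfolding vec_eq_iff one_tensor_mat_mult_nth by (simp add: sum_coord_proj)
  then show "discriminable I (\<lambda>m. (mat 1 \<otimes>\<^sub>m coord_proj (id R')) *v f m)" if "R' \<in> {R, - R}" for R'
    using that assms by auto
qed auto

section \<open>Rank-one projections and measurements along an orthogonal family\<close>

lemma hinner_eq_0_iff: "hinner v v = 0 \<longleftrightarrow> v = 0"
proof -
  have "hinner v v = of_real (\<Sum>i\<in>UNIV. (cmod (v $ i))\<^sup>2)"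
    by (simp add: hinner_def mult.commute[of "cnj _"] complex_norm_square[symmetric])
  then have "hinner v v = 0 \<longleftrightarrow> (\<Sum>i\<in>UNIV. (cmod (v $ i))\<^sup>2) = 0"
    by (simp only: of_real_eq_0_iff)
  then show ?thesis
    by (simp add: sum_nonneg_eq_0_iff vec_eq_iff)
qed

lemma hinner_commute: "hinner u v = cnj (hinner v u)"
  by (simp add: hinner_def mult.commute)

text \<open>For \<open>v = 0\<close> this is the zero matrix, since division by zero gives zero.\<close>

definition line_proj :: "complex^'n \<Rightarrow> complex^'n^'n" where
  "line_proj v = (\<chi> p q. v $ p * cnj (v $ q) / hinner v v)"

lemma line_proj_mult_vec: "line_proj v *v u = (hinner v u / hinner v v) *s v"
  by (simp add: vec_eq_iff line_proj_def matrix_vector_mult_def hinner_def[of v u]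
      sum_distrib_right sum_distrib_left sum_divide_distrib mult_ac)

lemma dagger_line_proj: "dagger (line_proj v) = line_proj v"
  by (simp add: vec_eq_iff dagger_def line_proj_def mult.commute hinner_commute[of v v, symmetric])

lemma line_proj_mult_line_proj:
  "line_proj u ** line_proj v =
     (\<chi> p q. u $ p * hinner u v * cnj (v $ q) / (hinner u u * hinner v v))"
  by (simp add: vec_eq_iff line_proj_def matrix_matrix_mult_def hinner_def[of u v]
      sum_distrib_right sum_distrib_left sum_divide_distrib mult_ac)

lemma line_proj_idem: "line_proj v ** line_proj v = line_proj v"
  unfolding line_proj_mult_line_proj by (simp add: vec_eq_iff line_proj_def)

lemma line_proj_orthogonal: "hinner u v = 0 \<Longrightarrow> line_proj u ** line_proj v = 0"
  unfolding line_proj_mult_line_proj by (simp add: vec_eq_iff)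

lemma sum_matrix_mult: "(\<Sum>m\<in>I. A m) ** B = (\<Sum>m\<in>I. A m ** (B :: complex^'n^'n))"
  by (simp add: vec_eq_iff matrix_matrix_mult_def sum_distrib_right sum.swap[of _ I])

lemma mult_sum_matrix: "B ** (\<Sum>m\<in>I. A m) = (\<Sum>m\<in>I. (B :: complex^'n^'n) ** A m)"
  by (simp add: vec_eq_iff matrix_matrix_mult_def sum_distrib_left sum.swap[of _ I])

lemma matrix_mult_diff_distrib: "A ** (B - C) = A ** B - A ** (C :: complex^'n^'n)"
  by (simp add: vec_eq_iff matrix_matrix_mult_def right_diff_distrib sum_subtractf)

lemma matrix_mult_diff_rdistrib: "(A - B) ** C = A ** C - B ** (C :: complex^'n^'n)"
  by (simp add: vec_eq_iff matrix_matrix_mult_def left_diff_distrib sum_subtractf)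

lemma sum_matrix_vector_mult: "(\<Sum>m\<in>I. A m) *v v = (\<Sum>m\<in>I. A m *v (v :: complex^'n))"
  by (induction I rule: infinite_finite_induct)
    (simp_all add: matrix_vector_mult_add_rdistrib)

text \<open>The line projections are completed by the projection onto the orthogonal complement of
  all \<open>v m\<close>, with outcome \<open>None\<close>. Some \<open>v m\<close> may vanish, as
  happens to states restricted to a strip that they miss.\<close>

lemma orthogonal_measurement:
  fixes v :: "'i \<Rightarrow> complex^'n"
  assumes "finite I" and orth: "pairwise (\<lambda>m m'. hinner (v m) (v m') = 0) I"
  obtains M :: "'i option \<Rightarrow> complex^'n^'n" where
    "(\<Sum>x\<in>insert None (Some ` I). dagger (M x) ** M x) = mat 1"
    "\<forall>x\<in>insert None (Some ` I). \<forall>m\<in>I. \<forall>m'\<in>I. M x *v v m \<noteq> 0 \<longrightarrow> M x *v v m' \<noteq> 0 \<longrightarrow> m = m'"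
proof -
  define Q where "Q = (\<Sum>m\<in>I. line_proj (v m))"
  define M where "M = (\<lambda>x. case x of None \<Rightarrow> mat 1 - Q | Some m \<Rightarrow> line_proj (v m))"
  have "Q ** line_proj (v m) = line_proj (v m)" if "m \<in> I" for m
  proof -
    have "Q ** line_proj (v m) = (\<Sum>m'\<in>I. if m' = m then line_proj (v m) else 0)"
      unfolding Q_def sum_matrix_mult
      by (intro sum.cong refl)
        (use that orth in \<open>auto simp: line_proj_idem pairwise_def intro!: line_proj_orthogonal\<close>)
    with that \<open>finite I\<close> show ?thesis by simp
  qed
  then have QQ: "Q ** Q = Q"
    by (subst (2) Q_def) (simp add: mult_sum_matrix, simp add: Q_def)
  have dQ: "dagger (mat 1 - Q) = mat 1 - Q"
  proof -
    have "cnj (line_proj v $ q $ p) = line_proj v $ p $ q" for v :: "complex^'n" and p q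
      using dagger_line_proj[of v] by (simp add: vec_eq_iff dagger_def)
    then show ?thesis
      by (simp add: vec_eq_iff dagger_def Q_def mat_def)
  qed
  have "(mat 1 - Q) ** (mat 1 - Q) = mat 1 - Q"
    by (simp add: matrix_mult_diff_distrib matrix_mult_diff_rdistrib QQ)
  then have measurement: "(\<Sum>x\<in>insert None (Some ` I). dagger (M x) ** M x) = mat 1"
    using \<open>finite I\<close>
    by (simp add: sum.reindex M_def dQ dagger_line_proj line_proj_idem flip: Q_def)
  have outcome: "m = m'" if "x \<in> insert None (Some ` I)" "m \<in> I" "m' \<in> I"
    "M x *v v m \<noteq> 0" "M x *v v m' \<noteq> 0" for x m m'
  proof (cases x)
    case None
    \<comment> \<open>\<open>Q\<close> fixes every \<open>v m\<close>, so \<open>mat 1 - Q\<close>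
      annihilates it and the outcome \<open>None\<close> never occurs.\<close>
    have "Q *v v m = (\<Sum>m'\<in>I. if m' = m then v m else 0)"
      unfolding Q_def sum_matrix_vector_mult
      by (intro sum.cong refl)
        (use that orth in \<open>auto simp: line_proj_mult_vec pairwise_def hinner_eq_0_iff vec_eq_iff\<close>)
    with that \<open>finite I\<close> None show ?thesis
      by (simp add: M_def matrix_vector_mult_diff_rdistrib)
  next
    case (Some k)
    then have "k = m" if "m \<in> I" "M x *v v m \<noteq> 0" for m
      using that orth \<open>x \<in> _\<close> by (auto simp: M_def line_proj_mult_vec pairwise_def)
    with that show ?thesis by metis
  qed
  show ?thesis
    by (rule that[OF measurement]) (use outcome in blast)
qed

lemma discriminable_Alice_orthogonal:
  fixes v :: "'i \<Rightarrow> complex^('a::finite)"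
  assumes "finite I" "pairwise (\<lambda>m m'. hinner (v m) (v m') = 0) I"
  shows "discriminable I (\<lambda>m. v m \<otimes>\<^sub>v w)"
proof -
  obtain M :: "'i option \<Rightarrow> complex^'a^'a" where
    M: "(\<Sum>x\<in>insert None (Some ` I). dagger (M x) ** M x) = mat 1"
    "\<forall>x\<in>insert None (Some ` I). \<forall>m\<in>I. \<forall>m'\<in>I. M x *v v m \<noteq> 0 \<longrightarrow> M x *v v m' \<noteq> 0 \<longrightarrow> m = m'"
    using orthogonal_measurement[OF assms] by blast
  show ?thesis
  proof (rule discriminable_Alice[OF _ M(1)], goal_cases)
    case (2 x)
    show ?case
      unfolding tensor_mat_one_mult_tensor_vec
      using M(2)[THEN bspec, OF 2] by (intro discriminable_finish) (metis tensor_vec_zero)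
  qed (use assms in simp)
qed

lemma discriminable_Bob_orthogonal:
  fixes v :: "'i \<Rightarrow> complex^('b::finite)"
  assumes "finite I" "pairwise (\<lambda>m m'. hinner (v m) (v m') = 0) I"
  shows "discriminable I (\<lambda>m. w \<otimes>\<^sub>v v m)"
proof -
  obtain M :: "'i option \<Rightarrow> complex^'b^'b" where
    M: "(\<Sum>x\<in>insert None (Some ` I). dagger (M x) ** M x) = mat 1"
    "\<forall>x\<in>insert None (Some ` I). \<forall>m\<in>I. \<forall>m'\<in>I. M x *v v m \<noteq> 0 \<longrightarrow> M x *v v m' \<noteq> 0 \<longrightarrow> m = m'"
    using orthogonal_measurement[OF assms] by blast
  show ?thesis
  proof (rule discriminable_Bob[OF _ M(1)], goal_cases)
    case (2 x)
    show ?case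
      unfolding one_tensor_mat_mult_tensor_vec
      using M(2)[THEN bspec, OF 2] by (intro discriminable_finish) (metis tensor_vec_zero)
  qed (use assms in simp)
qed

text \<open>
  The Kraus operators are proportional to \<open>|1\<dots>1\<rangle>\<langle>s|\<close> for the sign vectors \<open>s\<close>. Since the entries of
  \<open>s\<close> have equal modulus, this measurement erases the basis label without revealing it.
\<close>

definition sign_at :: "'n set \<Rightarrow> 'n \<Rightarrow> complex" where
  "sign_at T q = (if q \<in> T then -1 else 1)"

definition sign_kraus :: "'n set \<Rightarrow> complex^'n^'n" where
  "sign_kraus T = (\<chi> r q. sign_at T q / sqrt (CARD('n) * 2 ^ CARD('n)))"

lemma sum_sign_at:
  "(\<Sum>T\<in>UNIV. sign_at T p * sign_at T q) = (if p = q then 2 ^ CARD('n) else 0)"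
  for p q :: "'n::finite"
proof (cases "p = q")
  case True
  have "sign_at T q * sign_at T q = 1" for T
    by (simp add: sign_at_def)
  then have "(\<Sum>T\<in>UNIV. sign_at T q * sign_at T q) = of_nat (card (Pow (UNIV :: 'n set)))"
    by simp
  with True show ?thesis by (simp add: card_Pow del: Pow_UNIV)
next
  case False
  \<comment> \<open>Toggling membership of \<open>p\<close> is an involution that reverses the sign
    at \<open>p\<close> and keeps the one at \<open>q\<close>, so the sum equals its own
    negative.\<close>
  let ?flip = "\<lambda>T. if p \<in> T then T - {p} else insert p T"
  have "(\<Sum>T\<in>UNIV. sign_at T p * sign_at T q) = (\<Sum>T\<in>UNIV. - (sign_at T p * sign_at T q))"
    by (rule sum.reindex_bij_witness[of _ ?flip ?flip])
      (use False in \<open>auto simp: sign_at_def split: if_splits\<close>)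
  with False show ?thesis by (simp add: sum_negf)
qed

lemma sign_kraus_measurement:
  "(\<Sum>T\<in>UNIV. dagger (sign_kraus T) ** sign_kraus T) = (mat 1 :: complex^'n^'n)"
proof -
  let ?c = "complex_of_real (sqrt (CARD('n) * 2 ^ CARD('n)))"
  have c: "?c * ?c = of_nat CARD('n) * 2 ^ CARD('n)"
    by (simp only: of_real_mult[symmetric] real_sqrt_mult_self) simp
  have "cnj (sign_at T p) = sign_at T p" for T and p :: 'n
    by (simp add: sign_at_def)
  \<comment> \<open>All rows of \<open>sign_kraus T\<close> agree, so summing over the intermediate
    index only contributes the factor \<open>CARD('n)\<close>.\<close>
  then have "(dagger (sign_kraus T) ** sign_kraus T) $ p $ q =
      sign_at T p * sign_at T q * (of_nat CARD('n) / (?c * ?c))" for T and p q :: 'n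
    by (simp add: sign_kraus_def dagger_def matrix_matrix_mult_def)
  then have "(\<Sum>T\<in>UNIV. dagger (sign_kraus T) ** sign_kraus T) $ p $ q =
      (\<Sum>T\<in>UNIV. sign_at T p * sign_at T q) * (of_nat CARD('n) / (?c * ?c))" for p q :: 'n
    by (simp only: sum_component sum_distrib_right)
  then show ?thesis
    unfolding c sum_sign_at by (simp add: vec_eq_iff mat_def)
qed

section \<open>Labelled rectangles\<close>

text \<open>
  The state of Alice and Bob once Alice has written the label \<open>\<kappa> i\<close> of her basis state \<open>|i\<rangle>\<close> into
  both ancillas and only the cells \<open>(i, j)\<close> in \<open>T\<close> have survived.
\<close>

definition labelled ::
    "('m::finite \<Rightarrow> 'x::finite) \<Rightarrow> ('m \<times> 'n::finite) set \<Rightarrow> complex^('m \<times> 'n)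
      \<Rightarrow> complex^(('x \<times> 'm) \<times> ('x \<times> 'n))" where
  "labelled \<kappa> T \<phi> = vec_lambda (\<lambda>((a, i), (b, j)).
     if a = \<kappa> i \<and> b = \<kappa> i \<and> (i, j) \<in> T then \<phi> $ (i, j) else 0)"

text \<open>Orthogonality of the restrictions to \<open>T\<close>. Comparing list positions checks
  each pair once and also detects repeated nonzero states.\<close>

definition orthogonal_on ::
    "('m::finite \<times> 'n::finite) set \<Rightarrow> (complex^('m \<times> 'n)) list \<Rightarrow> bool" where
  "orthogonal_on T \<phi>s \<longleftrightarrow>
     sorted_wrt (\<lambda>\<phi> \<phi>'. (\<Sum>p\<in>T. cnj (\<phi> $ p) * \<phi>' $ p) = 0) \<phi>s"

lemma sorted_wrt_imp_pairwise:
  assumes "sorted_wrt R xs" "\<And>x y. R x y \<Longrightarrow> R y x"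
  shows "pairwise R (set xs)"
proof (rule pairwiseI)
  fix x y assume "x \<in> set xs" "y \<in> set xs" "x \<noteq> y"
  then obtain i j where "i < length xs" "j < length xs" "x = xs ! i" "y = xs ! j" "i \<noteq> j"
    by (metis in_set_conv_nth)
  with assms show "R x y"
    by (cases i j rule: linorder_cases) (auto simp: sorted_wrt_iff_nth_less)
qed

lemma orthogonal_on_imp_pairwise:
  assumes "orthogonal_on T \<phi>s"
  shows "pairwise (\<lambda>\<phi> \<phi>'. (\<Sum>p\<in>T. cnj (\<phi> $ p) * \<phi>' $ p) = 0) (set \<phi>s)"
proof (rule sorted_wrt_imp_pairwise[OF assms[unfolded orthogonal_on_def]])
  fix \<phi> \<phi>' :: "complex^('a \<times> 'b)"
  have "(\<Sum>p\<in>T. cnj (\<phi>' $ p) * \<phi> $ p) = cnj (\<Sum>p\<in>T. cnj (\<phi> $ p) * \<phi>' $ p)"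
    by (simp add: mult.commute)
  then show "(\<Sum>p\<in>T. cnj (\<phi>' $ p) * \<phi> $ p) = 0" if "(\<Sum>p\<in>T. cnj (\<phi> $ p) * \<phi>' $ p) = 0"
    using that by simp
qed

text \<open>In this form the orthogonality is checked after the entries of each state are computed once.\<close>

lemma orthogonal_on_rectangle:
  assumes "distinct is" "distinct js"
    and "sorted_wrt (\<lambda>u v. (\<Sum>(x, y)\<leftarrow>zip u v. cnj x * y) = 0)
           (map (\<lambda>\<phi>. map (($) \<phi>) (List.product is js)) \<phi>s)"
  shows "orthogonal_on (set is \<times> set js) \<phi>s"
proof -
  have "(\<Sum>(x, y)\<leftarrow>zip (map (($) \<phi>) ps) (map (($) \<phi>') ps). cnj x * y) =
      (\<Sum>p\<in>set ps. cnj (\<phi> $ p) * \<phi>' $ p)" if "distinct ps" for ps and \<phi> \<phi>' :: "complex^('a \<times> 'b)"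
    using that by (simp add: zip_map_map zip_same_conv_map comp_def sum_list_distinct_conv_sum_set)
  from this[OF distinct_product[OF assms(1,2)]] assms(3) show ?thesis
    by (simp add: sorted_wrt_map orthogonal_on_def)
qed

text \<open>Alice measures whether her row belongs to \<open>T1\<close>; as no row is shared, this
  keeps either \<open>T1\<close> or \<open>T2\<close> whole.\<close>

lemma discriminable_labelled_Alice_split:
  assumes "discriminable S (labelled \<kappa> T1)" "discriminable S (labelled \<kappa> T2)"
    and disj: "fst ` T1 \<inter> fst ` T2 = {}"
  shows "discriminable S (labelled \<kappa> (T1 \<union> T2))"
proof -
  define R where "R = fst ` T1"
  have R: "(i, j) \<in> T1 \<Longrightarrow> i \<in> R" "(i, j) \<in> T2 \<Longrightarrow> i \<notin> R" for i j
    using disj unfolding R_def by force+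
  have "(if fst z \<in> {(a, i). i \<in> R} then labelled \<kappa> (T1 \<union> T2) \<phi> $ z else 0) = labelled \<kappa> T1 \<phi> $ z"
    "(if fst z \<notin> {(a, i). i \<in> R} then labelled \<kappa> (T1 \<union> T2) \<phi> $ z else 0) = labelled \<kappa> T2 \<phi> $ z"
    for \<phi> z
  proof -
    obtain a i b j where z: "z = ((a, i), (b, j))" by (metis surj_pair)
    show "(if fst z \<in> {(a, i). i \<in> R} then labelled \<kappa> (T1 \<union> T2) \<phi> $ z else 0) = labelled \<kappa> T1 \<phi> $ z"
      "(if fst z \<notin> {(a, i). i \<in> R} then labelled \<kappa> (T1 \<union> T2) \<phi> $ z else 0) = labelled \<kappa> T2 \<phi> $ z"
      using R[of i j] by (auto simp: z labelled_def)
  qed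
  then show ?thesis
    using discriminable_Alice_split[of S "{(a, i). i \<in> R}" "labelled \<kappa> (T1 \<union> T2)"]
      assms(1,2) by simp
qed

text \<open>Bob sees the column \<open>j\<close> together with the label \<open>\<kappa> i\<close>,
  and these pairs tell \<open>T1\<close> from \<open>T2\<close>.\<close>

lemma discriminable_labelled_Bob_split:
  assumes "discriminable S (labelled \<kappa> T1)" "discriminable S (labelled \<kappa> T2)"
    and disj: "(\<lambda>(i, j). (\<kappa> i, j)) ` T1 \<inter> (\<lambda>(i, j). (\<kappa> i, j)) ` T2 = {}"
  shows "discriminable S (labelled \<kappa> (T1 \<union> T2))"
proof -
  define R where "R = (\<lambda>(i, j). (\<kappa> i, j)) ` T1"
  have R: "(i, j) \<in> T1 \<Longrightarrow> (\<kappa> i, j) \<in> R" "(i, j) \<in> T2 \<Longrightarrow> (\<kappa> i, j) \<notin> R" for i j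
    using disj unfolding R_def by force+
  have "(if snd z \<in> R then labelled \<kappa> (T1 \<union> T2) \<phi> $ z else 0) = labelled \<kappa> T1 \<phi> $ z"
    "(if snd z \<notin> R then labelled \<kappa> (T1 \<union> T2) \<phi> $ z else 0) = labelled \<kappa> T2 \<phi> $ z"
    for \<phi> z
  proof -
    obtain a i b j where z: "z = ((a, i), (b, j))" by (metis surj_pair)
    show "(if snd z \<in> R then labelled \<kappa> (T1 \<union> T2) \<phi> $ z else 0) = labelled \<kappa> T1 \<phi> $ z"
      "(if snd z \<notin> R then labelled \<kappa> (T1 \<union> T2) \<phi> $ z else 0) = labelled \<kappa> T2 \<phi> $ z"
      using R[of i j] by (auto simp: z labelled_def)
  qed
  then show ?thesis
    using discriminable_Bob_split[of S R "labelled \<kappa> (T1 \<union> T2)"]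
      assms(1,2) by simp
qed

text \<open>Within one row Alice's factor is a fixed basis vector, so the state is a product and
  Bob's factor carries the whole restriction.\<close>

lemma discriminable_labelled_row:
  fixes \<kappa> :: "'m::finite \<Rightarrow> 'x::finite" and J :: "'n::finite set"
  assumes "orthogonal_on ({i} \<times> J) \<phi>s"
  shows "discriminable (set \<phi>s) (labelled \<kappa> ({i} \<times> J))"
proof -
  define v :: "complex^('m \<times> 'n) \<Rightarrow> complex^('x \<times> 'n)"
    where "v \<phi> = vec_lambda (\<lambda>(b, j). if b = \<kappa> i \<and> j \<in> J then \<phi> $ (i, j) else 0)" for \<phi>
  have "labelled \<kappa> ({i} \<times> J) \<phi> $ ((a, i'), (b, j)) =
      (ket (\<kappa> i, i) \<otimes>\<^sub>v v \<phi>) $ ((a, i'), (b, j))" for \<phi> a i' b j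
    by (auto simp: labelled_def v_def tensor_vec_def ket_def axis_def)
  then have "labelled \<kappa> ({i} \<times> J) = (\<lambda>\<phi>. ket (\<kappa> i, i) \<otimes>\<^sub>v v \<phi>)"
    by (simp add: fun_eq_iff vec_eq_iff)
  moreover have "hinner (v \<phi>) (v \<phi>') = (\<Sum>p\<in>{i} \<times> J. cnj (\<phi> $ p) * \<phi>' $ p)" for \<phi> \<phi>'
  proof -
    have "(\<Sum>p\<in>{i} \<times> J. cnj (\<phi> $ p) * \<phi>' $ p) = (\<Sum>z\<in>{\<kappa> i} \<times> J. cnj (v \<phi> $ z) * v \<phi>' $ z)"
      by (rule sum.reindex_bij_witness[of _ "\<lambda>(b, j). (i, j)" "\<lambda>(i, j). (\<kappa> i, j)"])
        (auto simp: v_def)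
    also have "\<dots> = hinner (v \<phi>) (v \<phi>')"
      unfolding hinner_def by (rule sum.mono_neutral_left) (auto simp: v_def split: if_splits)
    finally show ?thesis by simp
  qed
  ultimately show ?thesis
    using discriminable_Bob_orthogonal[OF finite_set, of v \<phi>s "ket (\<kappa> i, i)"]
      orthogonal_on_imp_pairwise[OF assms]
    by simp
qed

text \<open>Bob's label may still be entangled with Alice's row. The sign measurement disentangles
  it, at the price of known signs on Alice's entries that preserve orthogonality.\<close>

lemma discriminable_labelled_column:
  fixes \<kappa> :: "'m::finite \<Rightarrow> 'x::finite" and I :: "'m set" and j :: "'n::finite"
  assumes "orthogonal_on (I \<times> {j}) \<phi>s"
  shows "discriminable (set \<phi>s) (labelled \<kappa> (I \<times> {j}))"
proof (rule discriminable_Bob[OF _ sign_kraus_measurement])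
  fix s :: "('x \<times> 'n) set"
  let ?c = "complex_of_real (sqrt (CARD('x \<times> 'n) * 2 ^ CARD('x \<times> 'n)))"
  define v :: "complex^('m \<times> 'n) \<Rightarrow> complex^('x \<times> 'm)"
    where "v \<phi> = vec_lambda (\<lambda>(a, i).
      if a = \<kappa> i \<and> i \<in> I then sign_at s (\<kappa> i, j) / ?c * \<phi> $ (i, j) else 0)"
    for \<phi>
  \<comment> \<open>The vector \<open>1\<close> has all entries one: whatever the state, Bob is left
    with it up to a scalar.\<close>
  have "((mat 1 \<otimes>\<^sub>m sign_kraus s) *v labelled \<kappa> (I \<times> {j}) \<phi>) $ z = (v \<phi> \<otimes>\<^sub>v 1) $ z" for \<phi> z
  proof -
    obtain a i b j' where z: "z = ((a, i), (b, j'))" by (metis surj_pair)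
    have "((mat 1 \<otimes>\<^sub>m sign_kraus s) *v labelled \<kappa> (I \<times> {j}) \<phi>) $ z =
        (\<Sum>q\<in>UNIV. if q = (\<kappa> i, j) then v \<phi> $ (a, i) else 0)"
      unfolding one_tensor_mat_mult_nth
      by (intro sum.cong refl) (auto simp: z labelled_def sign_kraus_def v_def split: if_splits)
    then show ?thesis by (simp add: z tensor_vec_def)
  qed
  then have "(\<lambda>\<phi>. (mat 1 \<otimes>\<^sub>m sign_kraus s) *v labelled \<kappa> (I \<times> {j}) \<phi>) = (\<lambda>\<phi>. v \<phi> \<otimes>\<^sub>v 1)"
    by (simp add: fun_eq_iff vec_eq_iff)
  \<comment> \<open>Each sign enters twice and squares to one, leaving only the
    normalization.\<close>
  moreover have "hinner (v \<phi>) (v \<phi>') = (\<Sum>p\<in>I \<times> {j}. cnj (\<phi> $ p) * \<phi>' $ p) / (?c * ?c)" for \<phi> \<phi>'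
  proof -
    have "(\<Sum>p\<in>I \<times> {j}. cnj (\<phi> $ p) * \<phi>' $ p / (?c * ?c)) =
        (\<Sum>z\<in>(\<lambda>i. (\<kappa> i, i)) ` I. cnj (v \<phi> $ z) * v \<phi>' $ z)"
      by (rule sum.reindex_bij_witness[of _ "\<lambda>(a, i). (i, j)" "\<lambda>(i, j). (\<kappa> i, i)"])
        (auto simp: v_def sign_at_def)
    also have "\<dots> = hinner (v \<phi>) (v \<phi>')"
      unfolding hinner_def by (rule sum.mono_neutral_left) (auto simp: v_def split: if_splits)
    finally show ?thesis by (simp add: sum_divide_distrib)
  qed
  ultimately show "discriminable (set \<phi>s) (\<lambda>\<phi>. (mat 1 \<otimes>\<^sub>m sign_kraus s) *v labelled \<kappa> (I \<times> {j}) \<phi>)"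
    using discriminable_Alice_orthogonal[OF finite_set, of v \<phi>s 1]
      orthogonal_on_imp_pairwise[OF assms]
    by (simp add: pairwise_def)
qed simp

section \<open>Writing the labels by means of the entangled pair\<close>

lemma max_entangled_nth: "max_entangled $ z = (if fst z = snd z then 1 else 0)"
proof -
  have "max_entangled $ z = (\<Sum>i\<in>UNIV. if i = fst z then if fst z = snd z then 1 else 0 else 0)"
    unfolding max_entangled_def sum_component
    by (intro sum.cong) (auto simp: tensor_vec_def ket_def axis_def)
  then show ?thesis by simp
qed

text \<open>
  Alice projects onto the subspaces \<open>a = k i + s\<close> with \<open>s = 0, 1, 2\<close>; every outcome \<open>s\<close> only
  permutes the labels.
\<close>

lemma locc_distinguishable_with_max_entangledI:
  fixes k :: "'m::finite \<Rightarrow> 3" and S :: "(complex^('m \<times> 'n::finite)) set"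
  assumes "\<And>s. discriminable S (labelled (\<lambda>i. k i + s) UNIV)"
  shows "locc_distinguishable_with (max_entangled :: complex^(3 \<times> 3)) S"
proof -
  let ?R = "\<lambda>s. {(a, i). a = k i + s}"
  have "discriminable S (with_ancilla (max_entangled :: complex^(3 \<times> 3)))"
  proof (rule discriminable_Alice[OF _ coord_proj_measurement[of UNIV ?R]])
    fix p :: "3 \<times> 'm"
    show "\<exists>!s. s \<in> UNIV \<and> p \<in> ?R s"
      by (rule ex1I[of _ "fst p - k (snd p)"]) (auto simp: algebra_simps)
  next
    fix s
    have "(coord_proj (?R s) \<otimes>\<^sub>m mat 1) *v with_ancilla (max_entangled :: complex^(3 \<times> 3)) \<phi> =
        labelled (\<lambda>i. k i + s) UNIV \<phi>" for \<phi> :: "complex^('m \<times> 'n)"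
      unfolding vec_eq_iff tensor_mat_one_mult_nth
      by (auto simp: sum_coord_proj with_ancilla_def labelled_def max_entangled_nth)
    with assms show "discriminable S (\<lambda>\<phi>. (coord_proj (?R s) \<otimes>\<^sub>m mat 1)
        *v with_ancilla (max_entangled :: complex^(3 \<times> 3)) \<phi>)"
      by simp
  qed simp_all
  \<comment> \<open>A nonzero probability forces a nonzero final vector, and here each state is its
    own index.\<close>
  then show ?thesis
    unfolding discriminable_def locc_distinguishable_with_def outcome_prob_def by fastforce
qed

section \<open>Orthogonality on the strips\<close>

lemma UNIV_5: "(UNIV :: 5 set) = {0, 1, 2, 3, 4}"
  by (rule sym, rule card_subset_eq) auto

lemma orthogonal_on_UNIV:
  fixes \<phi>s :: "(complex^(5 \<times> 5)) list"
  assumes "sorted_wrt (\<lambda>u v. (\<Sum>(x, y)\<leftarrow>zip u v. cnj x * y) = 0)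
    (map (\<lambda>\<phi>. map (($) \<phi>) (List.product [0, 1, 2, 3, 4] [0, 1, 2, 3, 4])) \<phi>s)"
  shows "orthogonal_on UNIV \<phi>s"
  using orthogonal_on_rectangle[OF _ _ assms]
  by (simp only: list.set UNIV_5[symmetric] UNIV_Times_UNIV) simp

text \<open>A repeated entry would be a nonzero vector orthogonal to itself.\<close>

lemma orthogonal_on_UNIV_imp_distinct:
  assumes "orthogonal_on UNIV \<phi>s" "\<And>\<phi>. \<phi> \<in> set \<phi>s \<Longrightarrow> \<phi> \<noteq> 0"
  shows "distinct \<phi>s"
proof -
  have "\<phi>s ! i \<noteq> \<phi>s ! j" if "i < j" "j < length \<phi>s" for i j
  proof
    assume "\<phi>s ! i = \<phi>s ! j"
    moreover have "hinner (\<phi>s ! i) (\<phi>s ! j) = 0"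
      using assms(1) that by (simp add: orthogonal_on_def hinner_def sorted_wrt_iff_nth_less)
    ultimately show False
      using assms(2)[of "\<phi>s ! j"] that by (simp add: hinner_eq_0_iff)
  qed
  then show ?thesis
    unfolding distinct_conv_nth by (metis linorder_neqE_nat)
qed

lemma locc_distinguishable_if_orthogonal_on_strips:
  fixes \<phi>s :: "(complex^(5 \<times> 5)) list"
  assumes "orthogonal_on ({0, 1, 2, 3} \<times> {4}) \<phi>s" "orthogonal_on ({2, 3} \<times> {1}) \<phi>s"
    and "orthogonal_on ({4} \<times> {1, 2, 3, 4}) \<phi>s" "orthogonal_on ({0} \<times> {0, 1, 2, 3}) \<phi>s"
    and "orthogonal_on ({1, 2, 3, 4} \<times> {0}) \<phi>s" "orthogonal_on ({1} \<times> {1, 2}) \<phi>s"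
    and "orthogonal_on ({3} \<times> {2, 3}) \<phi>s" "orthogonal_on ({1, 2} \<times> {3}) \<phi>s"
    and "orthogonal_on ({2} \<times> {2}) \<phi>s"
  shows "locc_distinguishable_with (max_entangled :: complex^(3 \<times> 3)) (set \<phi>s)"
proof (rule locc_distinguishable_with_max_entangledI)
  fix s :: 3
  \<comment> \<open>The classes \<open>{0, 1}\<close>, \<open>{2, 3}\<close>, \<open>{4}\<close>;
    adding \<open>s\<close> renames the labels without changing the partition.\<close>
  define k :: "5 \<Rightarrow> 3" where "k i = (if i \<in> {0, 1} then 0 else if i \<in> {2, 3} then 1 else 2)" for i
  let ?D = "\<lambda>T. discriminable (set \<phi>s) (labelled (\<lambda>i. k i + s) T)"
  note row = discriminable_labelled_row
  note column = discriminable_labelled_column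
  note Alice = discriminable_labelled_Alice_split and Bob = discriminable_labelled_Bob_split
  \<comment> \<open>\<open>?Tn\<close> consists of the strips from the \<open>n\<close>-th on and
    the centre. The protocol is assembled from its last split backwards.\<close>
  let ?T8 = "{1, 2} \<times> {3} \<union> {2} \<times> {2} :: (5 \<times> 5) set"
  let ?T7 = "{3} \<times> {2, 3} \<union> ?T8"
  let ?T6 = "{1} \<times> {1, 2} \<union> ?T7"
  let ?T5 = "{1, 2, 3, 4} \<times> {0} \<union> ?T6"
  let ?T4 = "{0} \<times> {0, 1, 2, 3} \<union> ?T5"
  let ?T3 = "{4} \<times> {1, 2, 3, 4} \<union> ?T4"
  let ?T2 = "{2, 3} \<times> {1} \<union> ?T3"
  have "?D ?T8"
    by (rule Bob[OF column[OF assms(8)] row[OF assms(9)]]) (simp add: k_def)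
  \<comment> \<open>Rows 2 and 3 carry the same label and both meet columns 2 and 3, so Bob could
    not make this split.\<close>
  from Alice[OF row[OF assms(7)] this] have "?D ?T7"
    by simp
  from Bob[OF row[OF assms(6)] this] have "?D ?T6"
    by (simp add: k_def)
  from Bob[OF column[OF assms(5)] this] have "?D ?T5"
    by (simp add: k_def)
  \<comment> \<open>Row 1 shares the label of row 0 and its columns 0 to 3 are still present, so
    again Alice has to split.\<close>
  from Alice[OF row[OF assms(4)] this] have "?D ?T4"
    by simp
  from Bob[OF row[OF assms(3)] this] have "?D ?T3"
    by (simp add: k_def)
  from Bob[OF column[OF assms(2)] this] have "?D ?T2"
    by (simp add: k_def)
  from Bob[OF column[OF assms(1)] this] have "?D ({0, 1, 2, 3} \<times> {4} \<union> ?T2)"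
    by (simp add: k_def)
  moreover have "{0, 1, 2, 3} \<times> {4} \<union> ?T2 = UNIV"
    unfolding UNIV_Times_UNIV[symmetric] UNIV_5 by auto
  ultimately show "?D UNIV" by simp
qed

section \<open>The seventeen states\<close>

lemma ket_nth [simp]: "ket i $ j = (if j = i then 1 else 0)"
  by (simp add: ket_def axis_def)

lemma tensor_vec_nth [simp]: "(u \<otimes>\<^sub>v w) $ (i, j) = u $ i * w $ j"
  by (simp add: tensor_vec_def)

lemma length_product_states: "length product_states = 17"
  by (simp add: product_states_def)

lemma product_states_neq_0:
  assumes "\<phi> \<in> set product_states"
  shows "\<phi> \<noteq> 0"
proof -
  have "\<exists>p. \<phi> $ p \<noteq> 0"
    using assms unfolding product_states_def
    \<comment> \<open>One cell from each of the eight strips; \<open>(0, 0)\<close> also serves the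
      last state, whose entries are all one.\<close>
    by (auto intro: exI[of _ "(0, 0)"] exI[of _ "(0, 4)"]
        exI[of _ "(4, 1)"] exI[of _ "(1, 0)"] exI[of _ "(1, 1)"] exI[of _ "(1, 3)"]
        exI[of _ "(3, 2)"] exI[of _ "(2, 1)"])
  then show ?thesis by auto
qed

text \<open>
  Unfolding with this equation affects only the mapped list in the premise and keeps
  \<^const>\<open>product_states\<close> folded in the conclusion.
\<close>

lemmas map_product_states =
  arg_cong[OF product_states_def, of "map f" for f, unfolded list.map]

lemmas orthogonal_on_strip =
  orthogonal_on_rectangle[where \<phi>s = product_states, unfolded map_product_states]

text \<open>One instance for each strip in the order of splitting, then the centre.\<close>

lemmas orthogonal_on_strips =
  orthogonal_on_strip[of "[0, 1, 2, 3]" "[4]", simplified]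
  orthogonal_on_strip[of "[2, 3]" "[1]", simplified]
  orthogonal_on_strip[of "[4]" "[1, 2, 3, 4]", simplified]
  orthogonal_on_strip[of "[0]" "[0, 1, 2, 3]", simplified]
  orthogonal_on_strip[of "[1, 2, 3, 4]" "[0]", simplified]
  orthogonal_on_strip[of "[1]" "[1, 2]", simplified]
  orthogonal_on_strip[of "[3]" "[2, 3]", simplified]
  orthogonal_on_strip[of "[1, 2]" "[3]", simplified]
  orthogonal_on_strip[of "[2]" "[2]", simplified]

lemmas orthogonal_on_grid =
  orthogonal_on_UNIV[where \<phi>s = product_states, unfolded map_product_states, simplified]

theorem theorem1:
  shows "card (set product_states) = 17
    \<and> pairwise (\<lambda>\<phi> \<phi>'. hinner \<phi> \<phi>' = 0) (set product_states)
    \<and> locc_distinguishable_with (max_entangled :: complex^(3 \<times> 3)) (set product_states)"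
proof (intro conjI)
  show "card (set product_states) = 17"
    using orthogonal_on_UNIV_imp_distinct[OF orthogonal_on_grid product_states_neq_0]
    by (simp add: distinct_card length_product_states)
  show "pairwise (\<lambda>\<phi> \<phi>'. hinner \<phi> \<phi>' = 0) (set product_states)"
    using orthogonal_on_imp_pairwise[OF orthogonal_on_grid] by (simp add: hinner_def)
  show "locc_distinguishable_with (max_entangled :: complex^(3 \<times> 3)) (set product_states)"
    by (rule locc_distinguishable_if_orthogonal_on_strips) (simp_all add: orthogonal_on_strips)
qed

end
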